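(* Let $\varphi \in \mathbb{Z}[z]$ be the polynomial $\varphi(z) = z^d + c$, where $c, d \in \mathbb{Z}$ and $d \geq 2$. Suppose that zero is a wandering point of $\varphi$, and write $b_n = \varphi^n(0)$ for $n \geq 1$. Then: (1) If $c = \pm 1$, then $b_n$ contains a primitive prime divisor for all $n \geq 2$. (2) For all other $c \in \mathbb{Z}$, $b_n$ contains a primitive prime divisor for all $n \geq 1$.
   Context: Here $\varphi^n = \varphi \circ \varphi \circ \dots \circ \varphi$ ($n$ times) denotes the $n$-th iterate of $\varphi$. The orbit of $\alpha \in \mathbb{Z}$ under $\varphi$ is the set $\{\varphi(\alpha), \varphi^2(\alpha), \dots\}$; $\alpha$ is called a wandering point of $\varphi$ if this orbit is infinite. Given a sequence of integers $(b_n) = (b_1, b_2, \dots)$, the term $b_n$ contains a primitive prime divisor (also called a primitive prime) if there exists a prime $p$ such that $p \mid b_n$ but $p \nmid b_i$ for all $1 \le i < n$. *)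

theory Defs
  imports "HOL-Computational_Algebra.Computational_Algebra"
begin

text \<open>The orbit starts at the first iterate, so \<open>\<alpha>\<close> itself belongs to it only if \<open>\<alpha>\<close> is periodic.\<close>

definition orbit :: "int poly \<Rightarrow> int \<Rightarrow> int set" where
  "orbit \<phi> \<alpha> = {(poly \<phi> ^^ n) \<alpha> | n. n \<ge> 1}"

definition wandering_point :: "int poly \<Rightarrow> int \<Rightarrow> bool" where
  "wandering_point \<phi> \<alpha> \<longleftrightarrow> infinite (orbit \<phi> \<alpha>)"

text \<open>Sequences are indexed from 1; the value \<open>b 0\<close> is never consulted when \<open>n \<ge> 1\<close>.\<close>

definition has_primitive_prime_divisor :: "(nat \<Rightarrow> int) \<Rightarrow> nat \<Rightarrow> bool" where
  "has_primitive_prime_divisor b n \<longleftrightarrow>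
     (\<exists>p. prime p \<and> p dvd b n \<and> (\<forall>i. 1 \<le> i \<and> i < n \<longrightarrow> \<not> p dvd b i))"

end

theory Submission
  imports Defs
begin

text \<open>Since \<open>\<phi>(z) \<equiv> \<phi>(0)\<close> modulo \<open>z\<^sup>2\<close>, the sequence satisfies \<open>b (k * i) \<equiv> b i\<close> modulo \<open>(b i)\<^sup>2\<close>.
  Hence a prime that first appears in \<open>b i\<close> divides exactly the terms \<open>b (k * i)\<close>, always to the same
  power. If \<open>b n\<close> had no primitive prime divisor, it would therefore divide the product of the
  earlier terms; but that product is smaller than \<open>\<bar>b n\<bar>\<close>.\<close>

text \<open>A repeated value would make the iteration eventually periodic: from index
  \<open>j\<close> it wraps round to index \<open>i\<close>, so the first \<open>j\<close> iterates
  exhaust the orbit.\<close>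

lemma funpow_neq_if_wandering:
  assumes "wandering_point \<phi> \<alpha>" and "i < j"
  shows "(poly \<phi> ^^ i) \<alpha> \<noteq> (poly \<phi> ^^ j) \<alpha>"
proof
  assume eq: "(poly \<phi> ^^ i) \<alpha> = (poly \<phi> ^^ j) \<alpha>"
  have "(poly \<phi> ^^ n) \<alpha> \<in> (\<lambda>k. (poly \<phi> ^^ k) \<alpha>) ` {..<j}" for n
  proof (induction n)
    case 0
    show ?case using \<open>i < j\<close> by (intro image_eqI[of _ _ 0]) auto
  next
    case (Suc n)
    then obtain k where k: "k < j" "(poly \<phi> ^^ n) \<alpha> = (poly \<phi> ^^ k) \<alpha>" by auto
    show ?case
    proof (cases "Suc k = j")
      case True
      then have "(poly \<phi> ^^ Suc n) \<alpha> = (poly \<phi> ^^ i) \<alpha>" using k eq by auto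
      then show ?thesis using \<open>i < j\<close> by blast
    next
      case False
      have "(poly \<phi> ^^ Suc n) \<alpha> = (poly \<phi> ^^ Suc k) \<alpha>" using k by simp
      then show ?thesis using False k(1) by (metis Suc_lessI image_eqI lessThan_iff)
    qed
  qed
  then have "orbit \<phi> \<alpha> \<subseteq> (\<lambda>k. (poly \<phi> ^^ k) \<alpha>) ` {..<j}"
    unfolding orbit_def by auto
  then show False
    using assms(1) finite_subset unfolding wandering_point_def by blast
qed

lemma dvd_if_prime_powers_dvd:
  fixes a b :: int
  assumes "a \<noteq> 0" "b \<noteq> 0" and "\<And>p e. prime p \<Longrightarrow> e > 0 \<Longrightarrow> p ^ e dvd a \<Longrightarrow> p ^ e dvd b"
  shows "a dvd b"
proof (rule multiplicity_le_imp_dvd[OF assms(1)])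
  fix p :: int assume p: "prime p"
  show "multiplicity p a \<le> multiplicity p b"
  proof (cases "multiplicity p a = 0")
    case False
    then have "p ^ multiplicity p a dvd b"
      using assms(3) p multiplicity_dvd by blast
    then show ?thesis
      using p assms(2) by (intro multiplicity_geI) (auto simp: prime_elem_iff_prime_abs)
  qed simp
qed

text \<open>Fixing \<open>a 0 = 0\<close> lets the congruences below use index 0, where the sequence
  \<open>b\<close> of the theorem is unconstrained.\<close>

locale unicritical_iteration =
  fixes d :: nat and c :: int and a :: "nat \<Rightarrow> int"
  assumes d: "d \<ge> 2"
    and a_0: "a 0 = 0"
    and a_Suc: "a (Suc n) = a n ^ d + c"
begin

lemma dvd_shift_diff: "a i dvd a (n + i) - a n"
proof (induction n)
  case (Suc n)
  have "a (n + i) - a n dvd a (n + i) ^ d - a n ^ d"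
    by (metis dvd_triv_left power_diff_sumr2)
  with Suc show ?case by (auto simp: a_Suc intro: dvd_trans)
qed (simp add: a_0)

text \<open>The exponent \<open>d \<ge> 2\<close> enters at \<open>n = 1\<close>, where the
  difference is exactly \<open>a i ^ d\<close>; the recursion then preserves the congruence. At
  \<open>n = 0\<close> the difference is only \<open>a i\<close>.\<close>

lemma square_dvd_shift_diff:
  assumes "n \<ge> 1"
  shows "(a i)\<^sup>2 dvd a (n + i) - a n"
  using assms
proof (induction n rule: dec_induct)
  case base
  show ?case using d by (simp add: a_Suc a_0 le_imp_power_dvd power_0_left)
next
  case (step n)
  have "a (n + i) - a n dvd a (n + i) ^ d - a n ^ d"
    by (metis dvd_triv_left power_diff_sumr2)
  with step show ?case by (auto simp: a_Suc intro: dvd_trans)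
qed

lemma square_dvd_multiple_diff:
  assumes "i \<ge> 1"
  shows "(a i)\<^sup>2 dvd a (Suc k * i) - a i"
proof (induction k)
  case (Suc k)
  have "(a i)\<^sup>2 dvd a (Suc k * i + i) - a (Suc k * i)"
    using assms by (intro square_dvd_shift_diff) simp
  from dvd_add[OF this Suc] show ?case by (simp add: algebra_simps)
qed simp

lemma dvd_mod_diff: "a i dvd a n - a (n mod i)"
proof -
  have "a i dvd a (m + k * i) - a m" for k m
  proof (induction k)
    case (Suc k)
    from dvd_add[OF dvd_shift_diff[of i "m + k * i"] Suc] show ?case
      by (simp add: algebra_simps)
  qed simp
  from this[of "n mod i" "n div i"] show ?thesis by simp
qed

text \<open>The witness is the first index \<open>i\<close> with \<open>p dvd a i\<close>: it
  divides \<open>n\<close>, and the cofactor of \<open>a i\<close> in \<open>a n\<close> is coprime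
  to \<open>p\<close>.\<close>

lemma prime_power_dvd_earlier:
  assumes p: "prime p" and e: "e > 0" and dvd: "p ^ e dvd a n"
    and j: "1 \<le> j" "j < n" "p dvd a j"
  shows "\<exists>i. 1 \<le> i \<and> i < n \<and> p ^ e dvd a i"
proof -
  define i where "i = (LEAST i. 1 \<le> i \<and> p dvd a i)"
  have i: "1 \<le> i" "p dvd a i"
    using LeastI[of "\<lambda>i. 1 \<le> i \<and> p dvd a i" j] j unfolding i_def by auto
  have least: "i \<le> m" if "1 \<le> m" "p dvd a m" for m
    unfolding i_def using that by (intro Least_le) auto
  have "i < n" using least j by fastforce
  have "p dvd a n" using dvd e by (meson dvd_power dvd_trans)
  then have "p dvd a (n mod i)"
    using dvd_mod_diff[of i n] i(2) by (metis dvd_diff_right_iff dvd_trans)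
  \<comment> \<open>A nonzero remainder would be an index below \<open>i\<close> whose term
    \<open>p\<close> divides.\<close>
  then have "n mod i = 0"
    using least[of "n mod i"] i(1) mod_less_divisor[of i n] by linarith
  then have "n = (n div i) * i" by auto
  moreover from this have "n div i \<noteq> 0" using \<open>i < n\<close> i(1) by (simp add: div_eq_0_iff)
  ultimately obtain k where k: "n = Suc k * i" by (metis not0_implies_Suc)
  obtain q where "a n - a i = (a i)\<^sup>2 * q"
    using square_dvd_multiple_diff[OF i(1), of k] k by (auto elim: dvdE)
  then have q: "a n = a i * (1 + a i * q)"
    by (simp add: algebra_simps power2_eq_square)
  \<comment> \<open>The cofactor is 1 modulo \<open>p\<close>, so all of \<open>p ^ e\<close> must
    come from \<open>a i\<close>.\<close>
  have "\<not> p dvd 1 + a i * q"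
    using i(2) p by (metis dvd_add_left_iff dvd_mult2 not_prime_unit)
  then have "coprime (p ^ e) (1 + a i * q)"
    using p by (simp add: prime_imp_coprime)
  then have "p ^ e dvd a i"
    using dvd q by (simp add: coprime_dvd_mult_left_iff)
  with i \<open>i < n\<close> show ?thesis by blast
qed

text \<open>For \<open>n = 1\<close> the product is empty, and the size condition becomes
  \<open>\<bar>a 1\<bar> > 1\<close>.\<close>

lemma has_primitive_prime_divisor_if_large:
  assumes nz: "\<And>i. i \<ge> 1 \<Longrightarrow> a i \<noteq> 0" and "n \<ge> 1"
    and large: "(\<Prod>i\<in>{1..<n}. \<bar>a i\<bar>) < \<bar>a n\<bar>"
  shows "has_primitive_prime_divisor a n"
proof (rule ccontr)
  assume none: "\<not> has_primitive_prime_divisor a n"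
  define P where "P = (\<Prod>i\<in>{1..<n}. \<bar>a i\<bar>)"
  have "P > 0" unfolding P_def using nz by (intro prod_pos) auto
  have "a n dvd P"
  proof (rule dvd_if_prime_powers_dvd)
    fix p e assume p: "prime (p :: int)" "e > 0" "p ^ e dvd a n"
    then have "p dvd a n" by (meson dvd_power dvd_trans)
    then obtain j where "1 \<le> j" "j < n" "p dvd a j"
      using none p unfolding has_primitive_prime_divisor_def by auto
    then obtain i where "1 \<le> i" "i < n" "p ^ e dvd \<bar>a i\<bar>"
      using prime_power_dvd_earlier[OF p] by fastforce
    moreover from this have "\<bar>a i\<bar> dvd P" unfolding P_def by (intro dvd_prodI) auto
    ultimately show "p ^ e dvd P" by (meson dvd_trans)
  qed (use nz \<open>n \<ge> 1\<close> \<open>P > 0\<close> in auto)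
  then have "\<bar>a n\<bar> \<le> P" using \<open>P > 0\<close> by (simp add: zdvd_imp_le)
  then show False using large P_def by simp
qed

text \<open>The exception \<open>z\<^sup>2 - 2\<close>, with \<open>0 \<mapsto> -2 \<mapsto> 2 \<mapsto> 2\<close>, is excluded by injectivity.\<close>

lemma abs_second_gt_first:
  assumes inj: "\<And>i j. i < j \<Longrightarrow> a i \<noteq> a j"
  shows "\<bar>a 2\<bar> > \<bar>c\<bar>"
proof -
  have a1: "a 1 = c" using a_Suc[of 0] d by (simp add: a_0)
  have a2: "a 2 = c * (c ^ (d - 1) + 1)"
    using a_Suc[of 1] a1 d
    by (simp add: numeral_2_eq_2 algebra_simps flip: power_Suc)
  have c: "c \<noteq> 0" using inj[of 0 1] a1 a_0 by simp
  have "c ^ (d - 1) + 1 \<noteq> 0" using inj[of 0 2] a2 a_0 by auto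
  \<comment> \<open>With -2, -1 and 0 all excluded as values of \<open>c ^ (d - 1)\<close>, the
    cofactor of \<open>c\<close> in \<open>a 2\<close> has absolute value at least 2.\<close>
  moreover have "c ^ (d - 1) \<noteq> -2"
  proof
    assume *: "c ^ (d - 1) = -2"
    then have abs: "\<bar>c\<bar> ^ (d - 1) = 2" by (simp flip: power_abs)
    then have "\<bar>c\<bar> \<noteq> 1" by auto
    then have "\<bar>c\<bar> \<ge> 2" using c by linarith
    have "d - 1 < 2"
    proof (rule ccontr)
      assume "\<not> d - 1 < 2"
      then have "\<bar>c\<bar> ^ 2 \<le> \<bar>c\<bar> ^ (d - 1)" using \<open>\<bar>c\<bar> \<ge> 2\<close> by (intro power_increasing) auto
      moreover have "2 ^ 2 \<le> \<bar>c\<bar> ^ 2" using \<open>\<bar>c\<bar> \<ge> 2\<close> by (intro power_mono) auto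
      ultimately show False using abs by simp
    qed
    then have "d = 2" using d by simp
    then have "c = -2" using * by simp
    then have "a 2 = 2" using a2 \<open>d = 2\<close> by simp
    moreover from this have "a 3 = 2"
      using a_Suc[of 2] \<open>d = 2\<close> \<open>c = -2\<close> by (simp add: numeral_3_eq_3 numeral_2_eq_2)
    ultimately show False using inj[of 2 3] by simp
  qed
  moreover have "c ^ (d - 1) \<noteq> 0" using c by simp
  ultimately have "\<bar>c ^ (d - 1) + 1\<bar> \<ge> 2" by linarith
  then have "\<bar>c\<bar> * 2 \<le> \<bar>a 2\<bar>"
    unfolding a2 abs_mult by (intro mult_left_mono) auto
  then show ?thesis using c by linarith
qed

lemma prod_earlier_less:
  assumes inj: "\<And>i j. i < j \<Longrightarrow> a i \<noteq> a j" and "n \<ge> 2"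
  shows "(\<Prod>i\<in>{1..<n}. \<bar>a i\<bar>) < \<bar>a n\<bar>"
proof -
  have a1: "a 1 = c" using a_Suc[of 0] d by (simp add: a_0)
  have pos: "\<bar>a i\<bar> \<ge> 1" if "i \<ge> 1" for i
    using inj[of 0 i] that by (simp add: a_0)
  \<comment> \<open>The second conjunct strengthens the induction: it controls the loss of
    \<open>\<bar>c\<bar>\<close> when passing from \<open>\<bar>a n\<bar> ^ d\<close> to
    \<open>\<bar>a (Suc n)\<bar>\<close>.\<close>
  from \<open>n \<ge> 2\<close> have "(\<Prod>i\<in>{1..<n}. \<bar>a i\<bar>) < \<bar>a n\<bar> \<and> \<bar>c\<bar> \<le> (\<Prod>i\<in>{1..<n}. \<bar>a i\<bar>)"
  proof (induction n rule: dec_induct)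
    case base
    have "{1..<2::nat} = {1}" by auto
    then show ?case using abs_second_gt_first[OF inj] a1 by simp
  next
    case (step n)
    define P where "P = (\<Prod>i\<in>{1..<n}. \<bar>a i\<bar>)"
    have P: "P + 1 \<le> \<bar>a n\<bar>" "\<bar>c\<bar> \<le> P" using step.IH by (auto simp: P_def)
    have Suc: "(\<Prod>i\<in>{1..<Suc n}. \<bar>a i\<bar>) = P * \<bar>a n\<bar>"
      using step.hyps by (simp add: P_def)
    have "P * \<bar>a n\<bar> + \<bar>a n\<bar> \<le> \<bar>a n\<bar>\<^sup>2"
      using mult_right_mono[OF P(1), of "\<bar>a n\<bar>"] by (simp add: algebra_simps power2_eq_square)
    also have "\<bar>a n\<bar>\<^sup>2 \<le> \<bar>a n\<bar> ^ d"
      using pos[of n] step.hyps d by (intro power_increasing) auto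
    also have "\<bar>a n\<bar> ^ d \<le> \<bar>a (Suc n)\<bar> + \<bar>c\<bar>"
      unfolding a_Suc power_abs[symmetric] by linarith
    \<comment> \<open>The surplus \<open>\<bar>a n\<bar>\<close> on the left outweighs
      \<open>\<bar>c\<bar>\<close>, since
      \<open>\<bar>c\<bar> \<le> P < \<bar>a n\<bar>\<close>.\<close>
    finally have "P * \<bar>a n\<bar> < \<bar>a (Suc n)\<bar>" using P by linarith
    moreover have "P * 1 \<le> P * \<bar>a n\<bar>"
      using P pos[of n] step.hyps by (intro mult_left_mono) auto
    ultimately show ?case using Suc P(2) by simp
  qed
  then show ?thesis ..
qed

end

theorem theorem3:
  fixes c :: int and d :: nat and \<phi> :: "int poly" and b :: "nat \<Rightarrow> int"
  assumes "d \<ge> 2"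
    and "\<phi> = monom 1 d + [:c:]"
    and "wandering_point \<phi> 0"
    and "\<And>n. n \<ge> 1 \<Longrightarrow> b n = (poly \<phi> ^^ n) 0"
  shows "(c = 1 \<or> c = -1 \<longrightarrow> (\<forall>n\<ge>2. has_primitive_prime_divisor b n)) \<and>
         (c \<noteq> 1 \<and> c \<noteq> -1 \<longrightarrow> (\<forall>n\<ge>1. has_primitive_prime_divisor b n))"
proof -
  define a where "a n = (poly \<phi> ^^ n) 0" for n
  interpret unicritical_iteration d c a
    by unfold_locales (use assms(1) in \<open>simp_all add: a_def assms(2) poly_monom\<close>)
  have inj: "a i \<noteq> a j" if "i < j" for i j
    unfolding a_def using funpow_neq_if_wandering[OF assms(3) that] .
  have nz: "a i \<noteq> 0" if "i \<ge> 1" for i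
    using inj[of 0 i] that by (simp add: a_0)
  have a1: "a 1 = c" using a_Suc[of 0] d by (simp add: a_0)
  have ab: "has_primitive_prime_divisor b n \<longleftrightarrow> has_primitive_prime_divisor a n" if "n \<ge> 1" for n
    using that assms(4) by (auto simp: has_primitive_prime_divisor_def a_def)
  have ge2: "has_primitive_prime_divisor b n" if "n \<ge> 2" for n
    using that ab[of n] has_primitive_prime_divisor_if_large[OF nz, of n] prod_earlier_less[OF inj that]
    by simp
  \<comment> \<open>Wandering also rules out \<open>c = 0\<close>, so
    \<open>\<bar>a 1\<bar> = \<bar>c\<bar> \<ge> 2\<close> exceeds the empty product.\<close>
  have "has_primitive_prime_divisor b 1" if "c \<noteq> 1" "c \<noteq> -1"
    using that nz[of 1] a1 ab[of 1] has_primitive_prime_divisor_if_large[OF nz, of 1] by force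
  then have "has_primitive_prime_divisor b n" if "c \<noteq> 1" "c \<noteq> -1" "n \<ge> 1" for n
    using ge2[of n] that by (cases "n = 1") auto
  with ge2 show ?thesis by blast
qed

end
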